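(* Let $(a,b;c)$ be admissible hypergeometric parameters and let $p$ be a good prime for them. Then the following are equivalent: (i) for some index $j\ge0$, $\tau_j(c-1)>\tau_j(a-1)$ and $\tau_j(c-1)>\tau_j(b-1)$; (ii) ${}_2F_1(a,b;c;z)$ has $p$-adically unbounded coefficients. Moreover, if the coefficients of ${}_2F_1(a,b;c;z)$ are $p$-adically bounded, then they are all $p$-adic integers.
   Context: $(a,b;c)$ rational is admissible if $0<a,b,c<1$ and $c\ne a$, $c\ne b$. A prime $p$ is good if $v_p(a-1)=v_p(b-1)=v_p(c-1)=0$. ${}_2F_1(a,b;c;z)=\sum_{m\ge0}\frac{(a)_m(b)_m}{(c)_m}\frac{z^m}{m!}$ with $(x)_0=1$, $(x)_m=x(x+1)\cdots(x+m-1)$. For a $p$-adic integer $x$ and $j\ge0$, the truncation $\tau_j(x)$ is the unique integer with $0\le\tau_j(x)<p^j$ and $\tau_j(x)\equiv x\pmod{p^j}$. A series with rational coefficients $A_m$ has $p$-adically unbounded coefficients if $\inf_m v_p(A_m)=-\infty$; otherwise its coefficients are $p$-adically bounded. *)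

theory Defs
  imports "HOL-Computational_Algebra.Computational_Algebra" "HOL-Library.Extended_Real"
begin

definition padic_val :: "nat \<Rightarrow> rat \<Rightarrow> ereal" where
  "padic_val p x = (if x = 0 then \<infinity> else
     ereal (real (multiplicity (int p) (fst (quotient_of x)))
          - real (multiplicity (int p) (snd (quotient_of x)))))"

definition admissible :: "rat \<Rightarrow> rat \<Rightarrow> rat \<Rightarrow> bool" where
  "admissible a b c \<longleftrightarrow>
     0 < a \<and> a < 1 \<and> 0 < b \<and> b < 1 \<and> 0 < c \<and> c < 1 \<and> c \<noteq> a \<and> c \<noteq> b"

definition good_prime :: "nat \<Rightarrow> rat \<Rightarrow> rat \<Rightarrow> rat \<Rightarrow> bool" where
  "good_prime p a b c \<longleftrightarrow> prime p \<and>
     padic_val p (a - 1) = 0 \<and> padic_val p (b - 1) = 0 \<and> padic_val p (c - 1) = 0"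

text \<open>
  The congruence \<open>t \<equiv> x (mod p\<^sup>j)\<close> in the $p$-adic integers is expressed
  as $v_p(x - t) \ge j$. The value is meaningful only for rational \<open>x\<close> with $v_p(x) \ge 0$,
  that is, for rationals that are $p$-adic integers.
\<close>

definition truncation :: "nat \<Rightarrow> nat \<Rightarrow> rat \<Rightarrow> int" where
  "truncation p j x =
     (THE t. 0 \<le> t \<and> t < int p ^ j \<and> padic_val p (x - of_int t) \<ge> ereal (real j))"

definition hypergeo_2F1 :: "rat \<Rightarrow> rat \<Rightarrow> rat \<Rightarrow> rat fps" where
  "hypergeo_2F1 a b c = fps_hypergeo [a, b] [c] 1"

lemma hypergeo_2F1_nth:
  "fps_nth (hypergeo_2F1 a b c) m =
     pochhammer a m * pochhammer b m / (pochhammer c m * fact m)"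
  by (simp add: hypergeo_2F1_def)

definition padic_unbounded_coeffs :: "nat \<Rightarrow> rat fps \<Rightarrow> bool" where
  "padic_unbounded_coeffs p F \<longleftrightarrow> (INF m. padic_val p (fps_nth F m)) = -\<infinity>"

definition padic_bounded_coeffs :: "nat \<Rightarrow> rat fps \<Rightarrow> bool" where
  "padic_bounded_coeffs p F \<longleftrightarrow> \<not> padic_unbounded_coeffs p F"

definition padic_integer :: "nat \<Rightarrow> rat \<Rightarrow> bool" where
  "padic_integer p x \<longleftrightarrow> padic_val p x \<ge> 0"

end

theory Submission
  imports Defs "HOL-Number_Theory.Residues"
begin

text \<open>
  The \<open>p\<close>-adic valuation of \<open>(a)\<^sub>m\<close> is \<open>\<Sum>\<^sub>k \<lfloor>(m + \<tau>\<^sub>k(a - 1)) / p\<^sup>k\<rfloor>\<close>, so the valuation of the \<open>m\<close>-th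
  coefficient is the total over \<open>k\<close> of the number of carries out of the lowest \<open>k\<close> digits when \<open>m\<close>
  is added to \<open>a - 1\<close> and to \<open>b - 1\<close>, minus the number when it is added to \<open>c - 1\<close>. If
  \<open>\<tau>\<^sub>k(c - 1)\<close> never exceeds both other truncations, every summand is nonnegative. Otherwise some
  block of digits of \<open>m\<close> produces a negative total without carrying out of the sums with \<open>a - 1\<close>
  and \<open>b - 1\<close>. The expansions are purely periodic because the parameters lie between \<open>0\<close> and
  \<open>1\<close>, so repeating this block drives the valuation to minus infinity.
\<close>

section \<open>Valuations of fractions and floor division\<close>

lemma padic_val_of_int_divide:
  fixes x y :: int
  assumes "prime p" "x \<noteq> 0" "y \<noteq> 0"
  shows "padic_val p (of_int x / of_int y) =
           ereal (real (multiplicity (int p) x) - real (multiplicity (int p) y))"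
proof -
  obtain u v where uv: "quotient_of (of_int x / of_int y) = (u, v)"
    by fastforce
  have v: "v > 0" using quotient_of_denom_pos[OF uv] .
  have eq: "(of_int x / of_int y :: rat) = of_int u / of_int v" using quotient_of_div[OF uv] .
  then have "(of_int (x * v) :: rat) = of_int (u * y)" using v assms by (simp add: field_simps)
  then have xv: "x * v = u * y" by (simp only: of_int_eq_iff)
  have u: "u \<noteq> 0" using xv v assms by auto
  have pe: "prime_elem (int p)" using assms by auto
  have "multiplicity (int p) x + multiplicity (int p) v = multiplicity (int p) u + multiplicity (int p) y"
    using arg_cong[OF xv, of "multiplicity (int p)"] u v assms
    by (simp add: prime_elem_multiplicity_mult_distrib[OF pe])
  then have "real (multiplicity (int p) x) + real (multiplicity (int p) v) =
      real (multiplicity (int p) u) + real (multiplicity (int p) y)"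
    by (simp only: of_nat_add[symmetric])
  then show ?thesis using assms uv by (simp add: padic_val_def)
qed

text \<open>The positive exponents \<open>k\<close> with \<open>p ^ k\<close> dividing
  \<open>x\<close> are exactly those up to the multiplicity. The upper limit \<open>K\<close> stays
  free so that several such sums can share one range.\<close>

lemma multiplicity_eq_sum_of_bool:
  fixes x :: int
  assumes "prime p" "x \<noteq> 0" "multiplicity (int p) x \<le> K"
  shows "int (multiplicity (int p) x) = (\<Sum>k=1..K. of_bool (int p ^ k dvd x))"
proof -
  have p: "\<not> is_unit (int p)" using assms(1) by (auto dest: not_prime_unit)
  have "(\<Sum>k=1..K. of_bool (int p ^ k dvd x) :: int) =
        int (card ({1..K} \<inter> {k. int p ^ k dvd x}))"
    by simp
  also have "{1..K} \<inter> {k. int p ^ k dvd x} = {1..multiplicity (int p) x}"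
    using assms p by (auto simp: power_dvd_iff_le_multiplicity)
  finally show ?thesis by simp
qed

lemma int_div_add_one:
  fixes x q :: int
  assumes "q > 0"
  shows "(x + 1) div q = x div q + of_bool (q dvd x + 1)"
proof (cases "q dvd x + 1")
  case True
  then obtain s where s: "x + 1 = q * s" by blast
  then have "x = q * (s - 1) + (q - 1)" by (simp add: algebra_simps)
  then have "x div q = s - 1" using assms by (intro int_div_pos_eq[of _ _ _ "q - 1"]) auto
  then show ?thesis using s True assms by simp
next
  case False
  have "x mod q + 1 \<noteq> q"
  proof
    assume "x mod q + 1 = q"
    then have "x + 1 = q * (x div q + 1)" using mult_div_mod_eq[of q x] unfolding distrib_left by linarith
    then show False using False by simp
  qed
  then have "x mod q + 1 < q" using pos_mod_bound[OF assms, of x] by simp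
  then have "(x + 1) div q = x div q"
    using mult_div_mod_eq[of q x] pos_mod_sign[OF assms, of x]
    by (intro int_div_pos_eq[of _ _ _ "x mod q + 1"]) auto
  then show ?thesis using False by simp
qed

section \<open>Truncations of p-adic expansions\<close>

text \<open>\<open>t\<close> is the sequence of truncations of the \<open>p\<close>-adic integer \<open>-n/d\<close>.\<close>

definition truncation_seq :: "nat \<Rightarrow> int \<Rightarrow> int \<Rightarrow> (nat \<Rightarrow> int) \<Rightarrow> bool" where
  "truncation_seq p n d t \<longleftrightarrow> prime p \<and> 0 \<le> n \<and> n < d \<and> coprime d (int p) \<and>
     (\<forall>k. 0 \<le> t k \<and> t k < int p ^ k \<and> int p ^ k dvd n + t k * d)"

lemma truncation_unique:
  fixes d :: int
  assumes "coprime d q" "0 \<le> s" "s < q" "0 \<le> t" "t < q" "q dvd n + s * d" "q dvd n + t * d"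
  shows "s = t"
proof -
  have "q dvd (n + s * d) - (n + t * d)" using assms dvd_diff by blast
  then have "q dvd (s - t) * d" by (simp add: algebra_simps)
  then have "q dvd s - t" using assms(1) by (simp add: coprime_commute coprime_dvd_mult_left_iff)
  then have "s mod q = t mod q" by (simp add: mod_eq_dvd_iff)
  then show ?thesis using assms by simp
qed

text \<open>As \<open>d\<close> is a unit at \<open>p\<close>, the valuation of \<open>x - t\<close>
  is that of the integer \<open>n + t * d\<close>. This turns the defining condition of
  \<open>truncation\<close> into a divisibility, which invertibility of \<open>d\<close> modulo
  \<open>p ^ k\<close> solves uniquely.\<close>

lemma truncation_seqI:
  fixes n d :: int
  assumes p: "prime p" and n: "0 < n" "n < d" and d: "coprime d (int p)"
    and x: "x = - of_int n / of_int d"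
  shows "truncation_seq p n d (\<lambda>k. truncation p k x)"
  unfolding truncation_seq_def
proof (intro conjI allI)
  fix k
  let ?q = "int p ^ k"
  have q: "?q > 0" using p by (simp add: prime_gt_0_nat)
  have dq: "coprime d ?q" using d by simp
  have char: "padic_val p (x - of_int t) \<ge> ereal (real k) \<longleftrightarrow> ?q dvd n + t * d" for t
  proof (cases "n + t * d = 0")
    case True
    then have "n = - t * d" by simp
    then have "x - of_int t = 0" using n x by simp
    then show ?thesis using True by (simp add: padic_val_def)
  next
    case False
    have "x - of_int t = of_int (n + t * d) / of_int (- d)"
      using n x by (simp add: field_simps)
    moreover have "multiplicity (int p) (- d) = 0"
      using d p by (metis coprime_commute coprime_absorb_left dvd_minus_iff not_dvd_imp_multiplicity_0
          not_prime_unit prime_nat_int_transfer)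
    ultimately have "padic_val p (x - of_int t) = ereal (real (multiplicity (int p) (n + t * d)))"
      using padic_val_of_int_divide[OF p, of "n + t * d" "- d"] False n
      by simp
    moreover have "?q dvd n + t * d \<longleftrightarrow> k \<le> multiplicity (int p) (n + t * d)"
      using False p by (subst power_dvd_iff_le_multiplicity) (auto dest: not_prime_unit)
    ultimately show ?thesis by simp
  qed
  obtain e where e: "[d * e = 1] (mod ?q)" using cong_solve_coprime_int[OF dq] by blast
  define t where "t = (- n * e) mod ?q"
  have t: "0 \<le> t" "t < ?q" using q by (auto simp: t_def)
  have "[n + t * d = n + (- n * e) * d] (mod ?q)"
    unfolding t_def by (intro cong_add cong_mult) (auto simp: cong_def)
  also have "n + (- n * e) * d = n + (- n) * (d * e)" by simp
  also have "[\<dots> = n + (- n) * 1] (mod ?q)" using e by (intro cong_add cong_mult) auto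
  finally have tq: "?q dvd n + t * d" by (simp add: cong_0_iff)
  have "truncation p k x = t"
    unfolding truncation_def char
    using t tq truncation_unique[OF dq] by (intro the_equality) blast+
  with t tq show "0 \<le> truncation p k x" "truncation p k x < ?q" "?q dvd n + truncation p k x * d"
    by auto
qed (use assms in auto)

lemma truncation_seq_bounds:
  assumes "truncation_seq p n d t"
  shows "0 \<le> t k" "t k < int p ^ k"
  using assms by (auto simp: truncation_seq_def)

lemma truncation_seq_dvd_diff:
  assumes t: "truncation_seq p n d t" and "k \<le> l"
  shows "int p ^ k dvd t l - t k"
proof -
  have "int p ^ k dvd n + t l * d"
    using t le_imp_power_dvd[OF \<open>k \<le> l\<close>, of "int p"] unfolding truncation_seq_def
    by (meson dvd_trans)
  moreover have "int p ^ k dvd n + t k * d" using t by (simp add: truncation_seq_def)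
  ultimately have "int p ^ k dvd (n + t l * d) - (n + t k * d)" by (rule dvd_diff)
  then have "int p ^ k dvd (t l - t k) * d" by (simp add: algebra_simps)
  then show ?thesis
    using t by (simp add: truncation_seq_def coprime_commute coprime_dvd_mult_left_iff)
qed

text \<open>A carry that does not leave the lowest \<open>j\<close> digits cannot leave any longer
  block: \<open>t k - t j\<close> is a multiple of \<open>p ^ j\<close> below \<open>p ^ k\<close>,
  hence at most \<open>p ^ k - p ^ j\<close>.\<close>

lemma truncation_seq_no_carry:
  assumes t: "truncation_seq p n d t" and "j \<le> k" and M: "M + t j < int p ^ j"
  shows "M + t k < int p ^ k"
proof -
  have "int p ^ j dvd int p ^ k - (t k - t j)"
    using truncation_seq_dvd_diff[OF t \<open>j \<le> k\<close>] le_imp_power_dvd[OF \<open>j \<le> k\<close>, of "int p"]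
    by (rule dvd_diff[rotated])
  moreover have "int p ^ k - (t k - t j) > 0"
    using truncation_seq_bounds[OF t, of k] truncation_seq_bounds[OF t, of j] by simp
  ultimately have "int p ^ j \<le> int p ^ k - (t k - t j)" by (rule zdvd_imp_le)
  then show ?thesis using M by simp
qed

text \<open>If \<open>d\<close> divides \<open>p\<^sup>f - 1\<close>, then \<open>-n/d = N/(1 - p\<^sup>f)\<close> with \<open>0 \<le> N < p\<^sup>f\<close>, so that the
  \<open>p\<close>-adic expansion is purely periodic with repeating block \<open>N\<close>.\<close>

lemma truncation_seq_periodic:
  assumes t: "truncation_seq p n d t" and f: "d dvd int p ^ f - 1"
  shows "t (f + k) = t f + int p ^ f * t k"
proof -
  let ?q = "int p ^ f"
  have q: "?q > 0" using t by (simp add: truncation_seq_def prime_gt_0_nat)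
  have nd: "0 \<le> n" "n < d" using t by (auto simp: truncation_seq_def)
  have cop: "coprime d (int p ^ l)" for l using t by (simp add: truncation_seq_def)
  obtain e where e: "?q - 1 = d * e" using f by blast
  have e0: "e \<ge> 0" using e q nd
    by (smt (verit) mult_pos_neg)
  define N where "N = n * e"
  have Nd: "N * d = n * (?q - 1)" by (simp add: N_def e)
  have N: "0 \<le> N" "N < ?q"
  proof -
    show "0 \<le> N" using e0 nd by (simp add: N_def)
    have "N \<le> d * e" using nd e0 unfolding N_def by (intro mult_right_mono) auto
    then show "N < ?q" using e by simp
  qed
  have "n + N * d = ?q * n" using Nd by (simp add: algebra_simps)
  then have tf: "t f = N"
    using truncation_unique[OF cop, of "t f" f N n] N t by (auto simp: truncation_seq_def)
  \<comment> \<open>Prefixing the block \<open>N\<close> to \<open>t k\<close> multiplies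
    \<open>n + t k * d\<close> by \<open>p ^ f\<close>, so the divisibility by \<open>p ^ k\<close>
    improves to \<open>p ^ (f + k)\<close>.\<close>
  have "n + (N + ?q * t k) * d = ?q * (n + t k * d)" using Nd by (simp add: algebra_simps)
  then have dv: "int p ^ (f + k) dvd n + (N + ?q * t k) * d"
    using t by (simp add: truncation_seq_def power_add)
  have "t k + 1 \<le> int p ^ k" using truncation_seq_bounds[OF t, of k] by simp
  then have "?q * (t k + 1) \<le> int p ^ (f + k)"
    unfolding power_add using q by (intro mult_left_mono) auto
  then have "N + ?q * t k < int p ^ (f + k)" using N by (simp add: algebra_simps)
  moreover have "0 \<le> N + ?q * t k" using N q truncation_seq_bounds[OF t, of k] by simp
  ultimately show ?thesis
    using truncation_unique[OF cop, of "t (f + k)" "f + k" "N + ?q * t k" n] dv t tf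
    by (auto simp: truncation_seq_def)
qed

section \<open>Valuations of products along arithmetic progressions\<close>

text \<open>Generalizes Legendre's formula. Modulo \<open>p ^ k\<close>, \<open>-n\<close> is
  \<open>t k * d\<close>, so the factor \<open>d - n + m * d\<close> is congruent to
  \<open>(m + t k + 1) * d\<close>. Hence \<open>p ^ k\<close> divides it exactly when the
  \<open>k\<close>-th quotient grows by one as \<open>m\<close> becomes \<open>Suc m\<close>. The
  bound \<open>K0\<close> avoids an infinite sum.\<close>

lemma multiplicity_prod_progression:
  assumes t: "truncation_seq p n d t"
  shows "\<exists>K0. \<forall>K\<ge>K0. int (multiplicity (int p) (\<Prod>i<m. d - n + int i * d)) =
           (\<Sum>k=1..K. (int m + t k) div int p ^ k)"
proof (induction m)
  case 0
  have "t k div int p ^ k = 0" for k using truncation_seq_bounds[OF t, of k] by simp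
  then show ?case by simp
next
  case (Suc m)
  then obtain K0 where K0: "\<And>K. K \<ge> K0 \<Longrightarrow>
    int (multiplicity (int p) (\<Prod>i<m. d - n + int i * d)) = (\<Sum>k=1..K. (int m + t k) div int p ^ k)"
    by blast
  have nd: "0 \<le> n" "n < d" and p: "prime p" using t by (auto simp: truncation_seq_def)
  have pos: "d - n + int i * d > 0" for i using nd by (simp add: add_pos_nonneg)
  define x where "x = d - n + int m * d"
  have x: "x > 0" using pos by (simp add: x_def)
  have pe: "prime_elem (int p)" using p by auto
  have dvd: "int p ^ k dvd x \<longleftrightarrow> int p ^ k dvd (int m + t k) + 1" for k
  proof -
    have "x + (n + t k * d) = (int m + t k + 1) * d" by (simp add: x_def algebra_simps)
    moreover have "int p ^ k dvd n + t k * d" using t by (simp add: truncation_seq_def)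
    ultimately have "int p ^ k dvd x \<longleftrightarrow> int p ^ k dvd (int m + t k + 1) * d"
      by (metis dvd_add_left_iff)
    also have "\<dots> \<longleftrightarrow> int p ^ k dvd int m + t k + 1"
      using t by (simp add: truncation_seq_def coprime_commute coprime_dvd_mult_left_iff)
    finally show ?thesis by simp
  qed
  have "int (multiplicity (int p) (\<Prod>i<Suc m. d - n + int i * d)) =
          (\<Sum>k=1..K. (int (Suc m) + t k) div int p ^ k)"
    if K: "K \<ge> max K0 (multiplicity (int p) x)" for K
  proof -
    have nz: "(\<Prod>i<m. d - n + int i * d) \<noteq> 0" using pos by (simp add: less_imp_neq[symmetric])
    have "int (multiplicity (int p) (\<Prod>i<Suc m. d - n + int i * d)) =
        int (multiplicity (int p) (\<Prod>i<m. d - n + int i * d)) + int (multiplicity (int p) x)"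
      using prime_elem_multiplicity_mult_distrib[OF pe nz, of x] x by (simp add: x_def)
    also have "\<dots> = (\<Sum>k=1..K. (int m + t k) div int p ^ k) + (\<Sum>k=1..K. of_bool (int p ^ k dvd x))"
      using K0[of K] multiplicity_eq_sum_of_bool[OF p, of x K] x K by simp
    also have "\<dots> = (\<Sum>k=1..K. (int m + t k) div int p ^ k + of_bool (int p ^ k dvd x))"
      by (simp add: sum.distrib)
    also have "\<dots> = (\<Sum>k=1..K. (int (Suc m) + t k) div int p ^ k)"
    proof (rule sum.cong)
      fix k
      have "int p ^ k > 0" using p by (simp add: prime_gt_0_nat)
      from int_div_add_one[OF this, of "int m + t k"]
      show "(int m + t k) div int p ^ k + of_bool (int p ^ k dvd x) =
          (int (Suc m) + t k) div int p ^ k"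
        by (simp add: dvd algebra_simps)
    qed simp
    finally show ?thesis .
  qed
  then show ?case by blast
qed

section \<open>Carry counts at one power of p\<close>

text \<open>For \<open>0 \<le> x, y, z < q\<close> this is the number of carries out of the lowest base-\<open>q\<close> digit
  when \<open>m\<close> is added to \<open>x\<close> and to \<open>y\<close>, minus the number when it is added to \<open>z\<close>.\<close>

definition carry_excess :: "int \<Rightarrow> int \<Rightarrow> int \<Rightarrow> int \<Rightarrow> int \<Rightarrow> int" where
  "carry_excess q x y z m = (m + x) div q + (m + y) div q - (m + z) div q - m div q"

text \<open>The larger of \<open>x\<close> and \<open>y\<close> gives a quotient at least that of
  \<open>z\<close>; the other still gives at least \<open>m div q\<close>.\<close>

lemma carry_excess_nonneg:
  assumes "q > 0" "0 \<le> x" "0 \<le> y" "z \<le> max x y"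
  shows "carry_excess q x y z m \<ge> 0"
proof -
  have le: "u \<le> v \<Longrightarrow> (m + u) div q \<le> (m + v) div q" for u v
    using assms(1) by (intro zdiv_mono1) auto
  have "z \<le> x \<or> z \<le> y" using assms by auto
  then show ?thesis
    using le[of z x] le[of z y] le[of 0 x] le[of 0 y] assms by (auto simp: carry_excess_def)
qed

lemma carry_excess_add_multiple:
  assumes "q > 0" "q dvd r"
  shows "carry_excess q x y z (m + r) = carry_excess q x y z m"
proof -
  obtain s where s: "r = q * s" using assms by blast
  have "(m + r + u) div q = s + (m + u) div q" for u
    using assms(1) div_mult_self2[of q "m + u" s] by (simp add: s algebra_simps)
  from this[of x] this[of y] this[of z] this[of 0] show ?thesis
    by (simp add: carry_excess_def)
qed

section \<open>Valuations of the hypergeometric coefficients\<close>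

lemma pochhammer_of_int_divide:
  fixes n d :: int
  assumes "0 < d" "a = of_int (d - n) / of_int d"
  shows "pochhammer a m = (of_int (\<Prod>i<m. d - n + int i * d) / of_int (d ^ m) :: rat)"
proof -
  have "pochhammer a m = (\<Prod>i<m. of_int (d - n + int i * d) / of_int d)"
    unfolding pochhammer_prod atLeast0LessThan
    by (rule prod.cong) (use assms in \<open>auto simp: field_simps\<close>)
  then show ?thesis by (simp add: prod_dividef)
qed


lemma padic_val_hypergeo_2F1_nth:
  fixes na nb nc da db dc :: int
  assumes ta: "truncation_seq p na da ta" and a: "a = of_int (da - na) / of_int da"
    and tb: "truncation_seq p nb db tb" and b: "b = of_int (db - nb) / of_int db"
    and tc: "truncation_seq p nc dc tc" and c: "c = of_int (dc - nc) / of_int dc"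
  shows "\<exists>K0. \<forall>K\<ge>K0. padic_val p (fps_nth (hypergeo_2F1 a b c) m) =
    ereal (of_int (\<Sum>k=1..K. carry_excess (int p ^ k) (ta k) (tb k) (tc k) (int m)))"
proof -
  have p: "prime p" using ta by (simp add: truncation_seq_def)
  have pe: "prime_elem (int p)" using p by auto
  define v where "v = (\<lambda>x::int. int (multiplicity (int p) x))"
  have vmult: "v (x * y) = v x + v y" if "x \<noteq> 0" "y \<noteq> 0" for x y
    using that by (simp add: v_def prime_elem_multiplicity_mult_distrib[OF pe])
  define U where "U = (\<lambda>n d. \<Prod>i<m. d - n + int i * d)"
  \<comment> \<open>The factorial is treated as a fourth progression, with \<open>n = 0\<close>,
    \<open>d = 1\<close> and all truncations zero; it yields the term \<open>m div q\<close> of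
    \<open>carry_excess\<close>.\<close>
  have t1: "truncation_seq p 0 1 (\<lambda>_. 0)"
    using p by (simp add: truncation_seq_def prime_gt_0_nat)
  have U1: "of_int (U 0 1) = (fact m :: rat)"
    using pochhammer_of_int_divide[of 1 "1::rat" 0 m] by (simp add: U_def pochhammer_fact)
  have U0: "U n d \<noteq> 0" if "truncation_seq p n d t" for n d t
  proof -
    have "0 \<le> n" "n < d" using that by (auto simp: truncation_seq_def)
    then have "d - n + int i * d > 0" for i by (simp add: add_pos_nonneg)
    then show ?thesis by (simp add: U_def less_imp_neq[symmetric])
  qed
  have d: "d ^ m \<noteq> 0" "v (d ^ m) = 0" if "truncation_seq p n d t" for n d t
  proof -
    from that have "coprime (d ^ m) (int p)" "d > 0" by (auto simp: truncation_seq_def)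
    moreover from this have "\<not> int p dvd d ^ m"
      using p by (metis coprime_commute coprime_absorb_left not_prime_unit prime_nat_int_transfer)
    ultimately show "d ^ m \<noteq> 0" "v (d ^ m) = 0"
      by (auto simp: v_def not_dvd_imp_multiplicity_0)
  qed
  note nz = U0[OF ta] U0[OF tb] U0[OF tc] U0[OF t1] d(1)[OF ta] d(1)[OF tb] d(1)[OF tc]
  have pos: "da > 0" "db > 0" "dc > 0"
    using ta tb tc by (auto simp: truncation_seq_def)
  have poch: "pochhammer x m = of_int (U n d) / of_int (d ^ m)"
    if "d > 0" "x = of_int (d - n) / of_int d" for x :: rat and n d
    unfolding U_def using pochhammer_of_int_divide[OF that] .
  have "fps_nth (hypergeo_2F1 a b c) m =
      of_int (U na da * U nb db * dc ^ m) / of_int (U nc dc * U 0 1 * da ^ m * db ^ m)"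
    using nz pos
    unfolding hypergeo_2F1_nth U1[symmetric] poch[OF pos(1) a] poch[OF pos(2) b] poch[OF pos(3) c]
    by (simp add: field_simps)
  also have "padic_val p \<dots> = ereal (of_int (v (U na da * U nb db * dc ^ m)
      - v (U nc dc * U 0 1 * da ^ m * db ^ m)))"
    using nz by (subst padic_val_of_int_divide[OF p]) (auto simp: v_def)
  also have "v (U na da * U nb db * dc ^ m) - v (U nc dc * U 0 1 * da ^ m * db ^ m) =
      v (U na da) + v (U nb db) - v (U nc dc) - v (U 0 1)"
    using nz by (simp add: vmult d(2)[OF ta] d(2)[OF tb] d(2)[OF tc])
  finally have val: "padic_val p (fps_nth (hypergeo_2F1 a b c) m) =
      ereal (of_int (v (U na da) + v (U nb db) - v (U nc dc) - v (U 0 1)))" .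
  obtain K1 K2 K3 K4 where K:
    "\<And>K. K \<ge> K1 \<Longrightarrow> v (U na da) = (\<Sum>k=1..K. (int m + ta k) div int p ^ k)"
    "\<And>K. K \<ge> K2 \<Longrightarrow> v (U nb db) = (\<Sum>k=1..K. (int m + tb k) div int p ^ k)"
    "\<And>K. K \<ge> K3 \<Longrightarrow> v (U nc dc) = (\<Sum>k=1..K. (int m + tc k) div int p ^ k)"
    "\<And>K. K \<ge> K4 \<Longrightarrow> v (U 0 1) = (\<Sum>k=1..K. (int m + 0) div int p ^ k)"
    using multiplicity_prod_progression[OF ta, of m] multiplicity_prod_progression[OF tb, of m]
      multiplicity_prod_progression[OF tc, of m] multiplicity_prod_progression[OF t1, of m]
    unfolding U_def v_def by blast
  have "v (U na da) + v (U nb db) - v (U nc dc) - v (U 0 1) =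
      (\<Sum>k=1..K. carry_excess (int p ^ k) (ta k) (tb k) (tc k) (int m))"
    if "K \<ge> Max {K1, K2, K3, K4}" for K
    using that K(1)[of K] K(2)[of K] K(3)[of K] K(4)[of K]
    by (simp add: carry_excess_def sum.distrib sum_subtractf)
  then show ?thesis unfolding val by (intro exI[of _ "Max {K1, K2, K3, K4}"]) simp
qed

section \<open>Blocks of digits with negative carry excess\<close>

text \<open>The block \<open>M\<close> complements the digits of \<open>-n\<^sub>c/d\<^sub>c\<close> in the positions from \<open>i\<close> to \<open>j - 1\<close>, where
  \<open>i\<close> is the last index before \<open>j\<close> at which neither of the other two truncations is smaller.
  Hence in each of these positions the third sum carries and at most one of the others does, and
  at position \<open>j\<close> only the third one carries.\<close>

lemma exists_negative_block:
  assumes ta: "truncation_seq p na da ta" and tb: "truncation_seq p nb db tb"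
    and tc: "truncation_seq p nc dc tc"
    and j: "ta j < tc j" "tb j < tc j"
  obtains M where "0 \<le> M" "M + ta j < int p ^ j" "M + tb j < int p ^ j"
    "\<And>k. carry_excess (int p ^ k) (ta k) (tb k) (tc k) M \<le> 0"
    "carry_excess (int p ^ j) (ta j) (tb j) (tc j) M \<le> - 1"
proof -
  have p: "prime p" using ta by (simp add: truncation_seq_def)
  have q: "int p ^ k > 0" for k using p by (simp add: prime_gt_0_nat)
  note bds = truncation_seq_bounds[OF ta] truncation_seq_bounds[OF tb] truncation_seq_bounds[OF tc]
  define P where "P = (\<lambda>k. tc k \<le> ta k \<and> tc k \<le> tb k)"
  define i where "i = Max {k. k \<le> j \<and> P k}"
  have "P 0" using bds[of 0] unfolding P_def by simp
  then have "i \<in> {k. k \<le> j \<and> P k}" unfolding i_def by (intro Max_in) auto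
  then have i: "i \<le> j" "P i" by auto
  have "i \<noteq> j" using i j by (auto simp: P_def)
  then have ij: "i < j" using i by simp
  have notP: "\<not> P k" if "i < k" "k \<le> j" for k
  proof
    assume "P k"
    then have "k \<le> i" unfolding i_def using that by (intro Max_ge) auto
    then show False using that by simp
  qed
  \<comment> \<open>The difference \<open>(tc k - tc i) - (t k - t i)\<close> is a positive multiple
    of \<open>p ^ i\<close>, hence at least \<open>p ^ i\<close>, which exceeds
    \<open>t i\<close>.\<close>
  have gap: "t k + tc i < tc k"
    if t: "truncation_seq p n d t" and "tc i \<le> t i" "t k < tc k" "i \<le> k" for n d t k
  proof -
    have "int p ^ i dvd tc k - tc i - (t k - t i)"
      using truncation_seq_dvd_diff[OF t] truncation_seq_dvd_diff[OF tc] that by (intro dvd_diff[of _ "tc k - tc i" "t k - t i"])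
    moreover have "tc k - tc i - (t k - t i) > 0" using that by simp
    ultimately have "int p ^ i \<le> tc k - tc i - (t k - t i)" by (rule zdvd_imp_le)
    then show ?thesis using truncation_seq_bounds[OF t, of i] by simp
  qed
  have gapa: "ta k + tc i < tc k" if "i \<le> k" "ta k < tc k" for k
    using gap[OF ta] that i by (auto simp: P_def)
  have gapb: "tb k + tc i < tc k" if "i \<le> k" "tb k < tc k" for k
    using gap[OF tb] that i by (auto simp: P_def)
  \<comment> \<open>By this choice \<open>M + tc j = p ^ j + tc i\<close> carries, whereas
    \<open>gapa\<close> and \<open>gapb\<close> keep the other two sums below
    \<open>p ^ j\<close>.\<close>
  define M where "M = int p ^ j - tc j + tc i"
  have M0: "0 \<le> M" using bds[of j] bds[of i] by (simp add: M_def)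
  have Ma: "M + ta j < int p ^ j" using gapa[of j] ij j by (simp add: M_def)
  have Mb: "M + tb j < int p ^ j" using gapb[of j] ij j by (simp add: M_def)
  have Mj: "M < int p ^ j" using Ma bds[of j] by simp
  have mid: "carry_excess (int p ^ k) (ta k) (tb k) (tc k) M \<le> 0 \<and>
     (ta k < tc k \<and> tb k < tc k \<longrightarrow> carry_excess (int p ^ k) (ta k) (tb k) (tc k) M \<le> - 1)"
    if k: "i < k" "k \<le> j" for k
  proof -
    \<comment> \<open>\<open>r\<close> has the shape of \<open>M\<close> with \<open>k\<close> in
      place of \<open>j\<close> and is congruent to \<open>M\<close> modulo \<open>p ^ k\<close>, so
      it may replace \<open>M\<close> at position \<open>k\<close>.\<close>
    define r where "r = int p ^ k - tc k + tc i"
    have "int p ^ k dvd int p ^ j - int p ^ k - (tc j - tc k)"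
      using le_imp_power_dvd[OF k(2), of "int p"] truncation_seq_dvd_diff[OF tc k(2)]
      by (intro dvd_diff[of _ _ "tc j - tc k"] dvd_diff[of _ "int p ^ j"]) auto
    moreover have "M = r + (int p ^ j - int p ^ k - (tc j - tc k))" by (simp add: M_def r_def)
    ultimately have eq: "carry_excess (int p ^ k) (ta k) (tb k) (tc k) M =
        carry_excess (int p ^ k) (ta k) (tb k) (tc k) r"
      using carry_excess_add_multiple[OF q] by simp
    \<comment> \<open>Since \<open>P k\<close> fails, one of \<open>ta k\<close>,
      \<open>tb k\<close> is below \<open>tc k\<close>, and the gap inequality applies to
      it.\<close>
    have ti: "tc i < tc k"
      using notP[OF k] gapa[of k] gapb[of k] k bds[of k] by (fastforce simp: P_def not_le)
    have r: "0 \<le> r" "r < int p ^ k" using ti bds[of k] bds[of i] by (auto simp: r_def)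
    have c1: "(r + tc k) div int p ^ k \<ge> 1"
      using zdiv_mono1[of "int p ^ k" "r + tc k" "int p ^ k"] bds[of i] q[of k]
      by (simp add: r_def)
    have r0: "r div int p ^ k = 0" using r by simp
    have le1: "(r + t) div int p ^ k \<le> 1" if "t < int p ^ k" for t
    proof -
      have "(r + t) div int p ^ k \<le> (int p ^ k - 1 + 1 * int p ^ k) div int p ^ k"
        using that r q[of k] by (intro zdiv_mono1) auto
      also have "\<dots> = 1" using q[of k] by (subst div_mult_self1) auto
      finally show ?thesis .
    qed
    have a0: "(r + ta k) div int p ^ k = 0" if "ta k < tc k"
      using gapa[of k] that k r bds[of k] by (intro div_pos_pos_trivial) (auto simp: r_def)
    have b0: "(r + tb k) div int p ^ k = 0" if "tb k < tc k"
      using gapb[of k] that k r bds[of k] by (intro div_pos_pos_trivial) (auto simp: r_def)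
    show ?thesis
      using notP[OF k] a0 b0 le1[of "ta k"] le1[of "tb k"] c1 r0 bds[of k]
      unfolding eq unfolding carry_excess_def P_def
      by (cases "ta k < tc k"; cases "tb k < tc k"; simp)
  qed
  have low: "carry_excess (int p ^ k) (ta k) (tb k) (tc k) M \<le> 0" if k: "k \<le> i" for k
  proof -
    \<comment> \<open>The number on the right is \<open>M\<close> itself: it is divisible by
      \<open>p ^ i\<close>, so its lowest \<open>k\<close> digits vanish and cause no carry.\<close>
    have "int p ^ k dvd int p ^ j - (tc j - tc i)"
      using le_imp_power_dvd[of k j "int p"] k i(1) truncation_seq_dvd_diff[OF tc i(1)]
        dvd_trans[OF le_imp_power_dvd[OF k, of "int p"]]
      by (intro dvd_diff[of _ _ "tc j - tc i"]) auto
    then have "carry_excess (int p ^ k) (ta k) (tb k) (tc k) M =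
        carry_excess (int p ^ k) (ta k) (tb k) (tc k) 0"
      using carry_excess_add_multiple[OF q, of k "int p ^ j - (tc j - tc i)" _ _ _ 0]
      by (simp add: M_def diff_diff_eq2 add_diff_eq diff_add_eq)
    then show ?thesis using bds[of k] by (simp add: carry_excess_def)
  qed
  have high: "carry_excess (int p ^ k) (ta k) (tb k) (tc k) M \<le> 0" if k: "j \<le> k" for k
  proof -
    have "0 \<le> (M + tc k) div int p ^ k" "0 \<le> M div int p ^ k"
      using M0 bds[of k] q[of k] by (simp_all add: pos_imp_zdiv_nonneg_iff)
    then show ?thesis using truncation_seq_no_carry[OF ta k Ma] truncation_seq_no_carry[OF tb k Mb] M0 bds[of k]
      by (simp add: carry_excess_def)
  qed
  show thesis
  proof (rule that[OF M0 Ma Mb])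
    show "carry_excess (int p ^ k) (ta k) (tb k) (tc k) M \<le> 0" for k
      using low[of k] mid[of k] high[of k] by linarith
    show "carry_excess (int p ^ j) (ta j) (tb j) (tc j) M \<le> - 1"
      using mid[of j] ij j by blast
  qed
qed

text \<open>By Euler's theorem any multiple of the totient of \<open>D\<close> serves as
  \<open>f\<close>; the factor \<open>j\<close> makes it large enough.\<close>

lemma exists_common_period:
  fixes D :: int
  assumes "prime p" "D > 0" "coprime D (int p)"
  shows "\<exists>f\<ge>j. D dvd int p ^ f - 1"
proof -
  have "coprime p (nat D)" using assms by (metis coprime_commute coprime_int_iff int_nat_eq less_imp_le)
  then have "[p ^ totient (nat D) = 1] (mod nat D)" by (rule euler_theorem)
  then have "[(p ^ totient (nat D)) ^ j = 1 ^ j] (mod nat D)" by (rule cong_pow)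
  then have "[p ^ (totient (nat D) * j) = 1] (mod nat D)" by (simp add: power_mult)
  then have "[int (p ^ (totient (nat D) * j)) = int 1] (mod int (nat D))"
    by (simp only: cong_int_iff)
  then have "D dvd int p ^ (totient (nat D) * j) - 1"
    using assms by (simp add: cong_iff_dvd_diff)
  moreover have "totient (nat D) * j \<ge> j"
    using assms totient_gt_0_iff[of "nat D"] by (simp add: Suc_le_eq)
  ultimately show ?thesis by blast
qed

text \<open>Let \<open>f\<close> be a common period of the three expansions. Replacing
  \<open>m\<close> by \<open>M + p ^ f * m\<close> inserts the block \<open>M\<close> below the
  digits of \<open>m\<close>: the lowest \<open>f\<close> positions contribute at most -1, and the
  higher ones contribute no more than they did for \<open>m\<close>.\<close>

lemma exists_very_negative_carry_excess:
  assumes ta: "truncation_seq p na da ta" and tb: "truncation_seq p nb db tb"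
    and tc: "truncation_seq p nc dc tc"
    and j: "ta j < tc j" "tb j < tc j"
  shows "\<exists>m\<ge>0. \<exists>K0. \<forall>K\<ge>K0.
    (\<Sum>k=1..K. carry_excess (int p ^ k) (ta k) (tb k) (tc k) m) \<le> - int N"
proof -
  have p: "prime p" using ta by (simp add: truncation_seq_def)
  have q: "int p ^ k > 0" for k using p by (simp add: prime_gt_0_nat)
  note bds = truncation_seq_bounds[OF ta] truncation_seq_bounds[OF tb] truncation_seq_bounds[OF tc]
  obtain M where M: "0 \<le> M" "M + ta j < int p ^ j" "M + tb j < int p ^ j"
    "\<And>k. carry_excess (int p ^ k) (ta k) (tb k) (tc k) M \<le> 0"
    "carry_excess (int p ^ j) (ta j) (tb j) (tc j) M \<le> - 1"
    using exists_negative_block[OF assms] by blast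
  have "da > 0" "db > 0" "dc > 0" "coprime da (int p)" "coprime db (int p)" "coprime dc (int p)"
    using ta tb tc by (auto simp: truncation_seq_def)
  then obtain f where f: "f \<ge> j" "da * db * dc dvd int p ^ f - 1"
    using exists_common_period[OF p, of "da * db * dc" j] by auto
  then have df: "da dvd int p ^ f - 1" "db dvd int p ^ f - 1" "dc dvd int p ^ f - 1"
    by (auto elim: dvd_mult_left dvd_mult_right)
  have nocarry: "M + ta f < int p ^ f" "M + tb f < int p ^ f"
    using truncation_seq_no_carry[OF ta f(1)] truncation_seq_no_carry[OF tb f(1)] M by auto
  have Mf: "M < int p ^ f" using nocarry bds[of f] by simp
  \<comment> \<open>All truncations at index 0 vanish, so \<open>j\<close> lies in the summation
    range from 1 to \<open>f\<close>.\<close>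
  have j0: "j \<noteq> 0" using j bds[of 0] by (intro notI) auto
  let ?E = "\<lambda>m k. carry_excess (int p ^ k) (ta k) (tb k) (tc k) m"
  have block: "(\<Sum>k=1..f. ?E (M + int p ^ f * m) k) \<le> - 1" for m
  proof -
    have "(\<Sum>k=1..f. ?E (M + int p ^ f * m) k) = (\<Sum>k=1..f. ?E M k)"
      by (intro sum.cong carry_excess_add_multiple q) (auto intro: dvd_mult2 le_imp_power_dvd)
    also have "\<dots> = ?E M j + (\<Sum>k\<in>{1..f} - {j}. ?E M k)"
      using j0 f by (intro sum.remove) auto
    also have "\<dots> \<le> - 1 + 0" using M by (intro add_mono sum_nonpos) auto
    finally show ?thesis by simp
  qed
  \<comment> \<open>By periodicity, position \<open>f + k\<close> sees \<open>m\<close> and the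
    truncations at \<open>k\<close>, plus the carry out of the block. Only the third sum can receive
    one, and it enters with a minus sign.\<close>
  have shift: "?E (M + int p ^ f * m) (f + k) \<le> ?E m k" for m k
  proof -
    have div: "(M + int p ^ f * m + (s + int p ^ f * u)) div int p ^ (f + k) =
        ((M + s) div int p ^ f + (m + u)) div int p ^ k" for s u
    proof -
      have "M + int p ^ f * m + (s + int p ^ f * u) = (M + s) + (m + u) * int p ^ f"
        by (simp add: algebra_simps)
      then have "(M + int p ^ f * m + (s + int p ^ f * u)) div int p ^ f = (M + s) div int p ^ f + (m + u)"
        using q[of f] by (simp only: div_mult_self1)
      then show ?thesis using q[of f] by (simp add: power_add zdiv_zmult2_eq)
    qed
    have "(M + ta f) div int p ^ f = 0" "(M + tb f) div int p ^ f = 0" "M div int p ^ f = 0"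
      using nocarry Mf M(1) bds[of f] by auto
    moreover have "(m + tc k) div int p ^ k \<le> ((M + tc f) div int p ^ f + (m + tc k)) div int p ^ k"
      using M(1) bds[of f] q by (intro zdiv_mono1) (auto simp: pos_imp_zdiv_nonneg_iff)
    ultimately show ?thesis
      using div[of "ta f" "ta k"] div[of "tb f" "tb k"] div[of "tc f" "tc k"] div[of 0 0]
      unfolding carry_excess_def truncation_seq_periodic[OF ta df(1)]
        truncation_seq_periodic[OF tb df(2)] truncation_seq_periodic[OF tc df(3)]
      by simp
  qed
  show ?thesis
  proof (induction N)
    case 0
    have "?E 0 k = 0" for k using bds[of k] by (simp add: carry_excess_def)
    then show ?case by (intro exI[of _ 0]) simp
  next
    case (Suc N)
    then obtain m K0 where m: "m \<ge> 0" and K0: "\<And>K. K \<ge> K0 \<Longrightarrow> (\<Sum>k=1..K. ?E m k) \<le> - int N"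
      by blast
    let ?m = "M + int p ^ f * m"
    have "(\<Sum>k=1..K. ?E ?m k) \<le> - int (Suc N)" if "K \<ge> f + K0" for K
    proof -
      define L where "L = K - f"
      have L: "K = f + L" "L \<ge> K0" using that by (auto simp: L_def)
      have "(\<Sum>k=1..f+L. ?E ?m k) = (\<Sum>k=1..f. ?E ?m k) + (\<Sum>k=f+1..f+L. ?E ?m k)"
        by (intro sum.ub_add_nat) simp
      also have "(\<Sum>k=f+1..f+L. ?E ?m k) = (\<Sum>k=1..L. ?E ?m (f + k))"
        using sum.shift_bounds_cl_nat_ivl[of "?E ?m" 1 f L] by (simp only: add.commute)
      also have "\<dots> \<le> (\<Sum>k=1..L. ?E m k)" by (intro sum_mono shift)
      finally show ?thesis using block[of m] K0[OF L(2)] L(1) by simp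
    qed
    moreover have "?m \<ge> 0" using M(1) m by simp
    ultimately show ?case by blast
  qed
qed

section \<open>The equivalence and p-adic integrality\<close>

text \<open>Write \<open>x - 1 = -n/d\<close> in lowest terms. If \<open>p\<close> divided
  \<open>d\<close>, it could not divide \<open>n\<close>, and the valuation would be negative
  instead of zero.\<close>

lemma obtain_truncation_seq:
  assumes "prime p" "0 < x" "x < 1" "padic_val p (x - 1) = 0"
  obtains n d :: int where "truncation_seq p n d (\<lambda>k. truncation p k (x - 1))"
    "x = of_int (d - n) / of_int d"
proof -
  obtain u d where ud: "quotient_of (x - 1) = (u, d)" by fastforce
  have d: "d > 0" using quotient_of_denom_pos[OF ud] .
  have eq: "x - 1 = of_int u / of_int d" using quotient_of_div[OF ud] .
  then have xu: "x = of_int (d - (- u)) / of_int d" using d by (simp add: field_simps)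
  have "u < 0" "d + u > 0"
    using assms(2,3) d eq xu by (auto simp: field_simps zero_less_divide_iff simp flip: of_int_add)
  have "coprime u d" using quotient_of_coprime[OF ud] .
  have "coprime d (int p)"
  proof (rule ccontr)
    assume "\<not> coprime d (int p)"
    then have pd: "int p dvd d"
      using assms(1) by (metis coprime_commute prime_imp_coprime prime_nat_int_transfer)
    then have "\<not> int p dvd u"
      using \<open>coprime u d\<close> assms(1) by (meson coprime_common_divisor not_prime_unit prime_nat_int_transfer)
    then have "multiplicity (int p) u = 0" by (rule not_dvd_imp_multiplicity_0)
    moreover have "multiplicity (int p) d > 0"
      using pd d assms(1) by (intro prime_multiplicity_gt_zero_iff[THEN iffD2]) auto
    ultimately show False using assms(3,4) ud by (auto simp: padic_val_def split: if_splits)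
  qed
  then have "truncation_seq p (- u) d (\<lambda>k. truncation p k (x - 1))"
    using assms(1) \<open>u < 0\<close> \<open>d + u > 0\<close> eq by (intro truncation_seqI) auto
  then show thesis using xu that by blast
qed

theorem theorem4p2:
  fixes a b c :: rat and p :: nat
  assumes "admissible a b c" and "good_prime p a b c"
  shows "((\<exists>j::nat. truncation p j (c - 1) > truncation p j (a - 1) \<and>
                  truncation p j (c - 1) > truncation p j (b - 1))
          \<longleftrightarrow> padic_unbounded_coeffs p (hypergeo_2F1 a b c))
       \<and> (padic_bounded_coeffs p (hypergeo_2F1 a b c)
          \<longrightarrow> (\<forall>m. padic_integer p (fps_nth (hypergeo_2F1 a b c) m)))"
proof -
  let ?ta = "\<lambda>k. truncation p k (a - 1)"
  let ?tb = "\<lambda>k. truncation p k (b - 1)"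
  let ?tc = "\<lambda>k. truncation p k (c - 1)"
  let ?A = "\<lambda>m. padic_val p (fps_nth (hypergeo_2F1 a b c) m)"
  have p: "prime p" using assms by (simp add: good_prime_def)
  obtain na da where ta: "truncation_seq p na da ?ta" and a: "a = of_int (da - na) / of_int da"
    using obtain_truncation_seq[OF p, of a] assms by (auto simp: admissible_def good_prime_def)
  obtain nb db where tb: "truncation_seq p nb db ?tb" and b: "b = of_int (db - nb) / of_int db"
    using obtain_truncation_seq[OF p, of b] assms by (auto simp: admissible_def good_prime_def)
  obtain nc dc where tc: "truncation_seq p nc dc ?tc" and c: "c = of_int (dc - nc) / of_int dc"
    using obtain_truncation_seq[OF p, of c] assms by (auto simp: admissible_def good_prime_def)
  note val = padic_val_hypergeo_2F1_nth[OF ta a tb b tc c]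
  have unbounded: "padic_unbounded_coeffs p (hypergeo_2F1 a b c)"
    if j: "?ta j < ?tc j" "?tb j < ?tc j" for j
    unfolding padic_unbounded_coeffs_def
  proof (rule ereal_bot)
    fix B :: real
    obtain N :: nat where N: "- B \<le> real N" using real_arch_simple by blast
    obtain m' K0 where m': "m' \<ge> 0" and K0: "\<And>K. K \<ge> K0 \<Longrightarrow>
        (\<Sum>k=1..K. carry_excess (int p ^ k) (?ta k) (?tb k) (?tc k) m') \<le> - int N"
      using exists_very_negative_carry_excess[OF ta tb tc j, of N] by blast
    obtain m where m: "m' = int m" using m' nonneg_int_cases by blast
    obtain K1 where K1: "\<And>K. K \<ge> K1 \<Longrightarrow> ?A m =
        ereal (of_int (\<Sum>k=1..K. carry_excess (int p ^ k) (?ta k) (?tb k) (?tc k) (int m)))"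
      using val[of m] by blast
    \<comment> \<open>Both eventual statements are evaluated at one common upper limit.\<close>
    let ?S = "\<Sum>k=1..max K0 K1. carry_excess (int p ^ k) (?ta k) (?tb k) (?tc k) (int m)"
    have "?S \<le> - int N" using K0[of "max K0 K1"] m by simp
    then have "real_of_int ?S \<le> B" using N by linarith
    then have "?A m \<le> ereal B" using K1[of "max K0 K1"] by (simp del: of_int_sum)
    then show "(INF m. ?A m) \<le> ereal B" by (rule INF_lower2[OF UNIV_I])
  qed
  have nonneg: "?A m \<ge> 0" if no: "\<nexists>j. ?ta j < ?tc j \<and> ?tb j < ?tc j" for m
  proof -
    obtain K where K: "?A m =
        ereal (of_int (\<Sum>k=1..K. carry_excess (int p ^ k) (?ta k) (?tb k) (?tc k) (int m)))"
      using val[of m] by blast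
    have "(\<Sum>k=1..K. carry_excess (int p ^ k) (?ta k) (?tb k) (?tc k) (int m)) \<ge> 0"
    proof (intro sum_nonneg carry_excess_nonneg)
      fix k
      show "?tc k \<le> max (?ta k) (?tb k)" using no by (meson max.cobounded1 max.cobounded2 not_le order.trans)
    qed (use p truncation_seq_bounds[OF ta] truncation_seq_bounds[OF tb] in \<open>auto simp: prime_gt_0_nat\<close>)
    then show ?thesis unfolding K by (simp del: of_int_sum)
  qed
  have bounded: "\<not> padic_unbounded_coeffs p (hypergeo_2F1 a b c)"
    if "\<nexists>j. ?ta j < ?tc j \<and> ?tb j < ?tc j"
  proof -
    have "(INF m. ?A m) \<ge> 0" by (intro INF_greatest nonneg[OF that])
    then show ?thesis by (auto simp: padic_unbounded_coeffs_def)
  qed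
  \<comment> \<open>Boundedness excludes (i) by contraposition of \<open>unbounded\<close>;
    \<open>nonneg\<close> then gives integrality of every coefficient.\<close>
  show ?thesis
    using unbounded bounded nonneg unfolding padic_bounded_coeffs_def padic_integer_def by blast
qed

end
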